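(* Let $X$ be a Fréchet sequence space over $\mathbb{K}\in\{\mathbb{R},\mathbb{C}\}$ in which $(e_n)_{n\ge 0}$ is a basis, and let $(\Omega,\mathcal{F},\mu,\tau)$ be a measure-preserving dynamical system. Let $k\ge 1$, let $(A_1,\dots,A_k)$ be a measurable partition of $\Omega$ with $\mu(A_l)>0$ for every $1\le l\le k$, and let $w^{(l)}=(w^{(l)}_n)_{n\ge1}$, $1\le l\le k$, be sequences of nonzero scalars in $\mathbb{K}$ for which the corresponding weighted shifts $B_{w^{(l)}}$ are continuous on $X$. For $\omega\in\Omega$ put $T(\omega)=B_{w^{(l)}}$ if $\omega\in A_l$, $T_n(\omega)=T(\tau^{n-1}\omega)\cdots T(\tau\omega)T(\omega)$ for $n\ge1$, and $\varepsilon_n(\omega)=w^{(l)}_n$ if $\omega\in A_l$, for $n\ge1$. Then for every $\omega\in\Omega$ the following assertions are equivalent: (1) the sequence $(T_n(\omega))_{n\ge1}$ is mixing; (2) $$\left(\prod_{l=1}^{n}\varepsilon_l(\tau^{n-l}\omega)\right)^{-1}e_{n}\longrightarrow 0\quad\text{in }X\text{ as } n\to\infty .$$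
   Context: A measure-preserving dynamical system $(\Omega,\mathcal{F},\mu,\tau)$ is a probability space with a measurable map $\tau:\Omega\to\Omega$ such that $\mu(\tau^{-1}(B))=\mu(B)$ for all $B\in\mathcal{F}$. A Fréchet sequence space $X$ is a linear subspace of $\mathbb{K}^{\mathbb{Z}_+}$ ($\mathbb{Z}_+=\{0,1,2,\dots\}$) endowed with a Fréchet space topology (complete, given by a separating increasing sequence of seminorms) such that the embedding $X\to\mathbb{K}^{\mathbb{Z}_+}$ is continuous, i.e. convergence in $X$ implies coordinatewise convergence. $e_n$ is the sequence with $e_n(j)=1$ if $j=n$ and $0$ otherwise; "$(e_n)_{n\ge0}$ is a basis" means each $e_n\in X$ and $(e_n)_{n\geq 0}$ is a (Schauder) basis of $X$. The weighted shift $B_w$ associated with a sequence $w=(w_n)_{n\ge1}$ of nonzero scalars is given by $B_we_0=0$ and $B_we_n=w_ne_{n-1}$ for $n\ge1$. A sequence $(S_n)_{n\ge1}$ of continuous maps on a metric space $X$ is mixing if for all nonempty open sets $U,V\subset X$ there is $N\ge1$ such that $S_n(U)\cap V\ne\emptyset$ for every $n\ge N$. *)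

theory Defs
  imports "HOL-Probability.Probability" "HOL-Library.Function_Algebras"
begin

text \<open>Sequences over the scalar field are functions \<open>nat \<Rightarrow> 'k\<close>, with the pointwise group
  structure of \<open>Function_Algebras\<close>. The scalar type is of class \<open>real_normed_field\<close>; \<open>real\<close> and
  \<open>complex\<close> are instances and, since the norm is multiplicative, there is no other one up to
  isomorphism (Gelfand--Mazur).\<close>

definition seq_scale :: "'k::real_normed_field \<Rightarrow> (nat \<Rightarrow> 'k) \<Rightarrow> nat \<Rightarrow> 'k"
  where "seq_scale c x = (\<lambda>j. c * x j)"

lemma vector_space_seq_scale: "vector_space seq_scale"
  by unfold_locales (auto simp: seq_scale_def fun_eq_iff algebra_simps)

definition unit_seq :: "nat \<Rightarrow> nat \<Rightarrow> 'k::real_normed_field"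
  where "unit_seq n = (\<lambda>j. if j = n then 1 else 0)"

definition seminorm_on :: "(nat \<Rightarrow> 'k::real_normed_field) set \<Rightarrow> ((nat \<Rightarrow> 'k) \<Rightarrow> real) \<Rightarrow> bool"
  where "seminorm_on X p \<longleftrightarrow>
    (\<forall>x\<in>X. 0 \<le> p x) \<and>
    (\<forall>x\<in>X. \<forall>y\<in>X. p (x + y) \<le> p x + p y) \<and>
    (\<forall>c. \<forall>x\<in>X. p (seq_scale c x) = norm c * p x)"

text \<open>The underlying set of the space is \<open>topspace T\<close>. Because the seminorms increase, the balls of
  the single seminorms \<open>p n\<close> form a neighbourhood base, and completeness may be expressed by
  sequences since the topology is metrizable.\<close>

definition frechet_topology_by ::
    "(nat \<Rightarrow> 'k::real_normed_field) topology \<Rightarrow> (nat \<Rightarrow> (nat \<Rightarrow> 'k) \<Rightarrow> real) \<Rightarrow> bool"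
  where "frechet_topology_by T p \<longleftrightarrow>
    (\<forall>n. seminorm_on (topspace T) (p n)) \<and>
    (\<forall>x\<in>topspace T. mono (\<lambda>n. p n x)) \<and>
    (\<forall>x\<in>topspace T. (\<forall>n. p n x = 0) \<longrightarrow> x = 0) \<and>
    (\<forall>U. openin T U \<longleftrightarrow>
      U \<subseteq> topspace T \<and> (\<forall>x\<in>U. \<exists>n. \<exists>r>0. {y \<in> topspace T. p n (y - x) < r} \<subseteq> U)) \<and>
    (\<forall>x. (\<forall>i. x i \<in> topspace T) \<and>
         (\<forall>n. \<forall>\<epsilon>>0. \<exists>N::nat. \<forall>i\<ge>N. \<forall>j\<ge>N. p n (x i - x j) < \<epsilon>) \<longrightarrow>
         (\<exists>y. limitin T x y sequentially))"

definition frechet_sequence_space :: "(nat \<Rightarrow> 'k::real_normed_field) topology \<Rightarrow> bool"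
  where "frechet_sequence_space T \<longleftrightarrow>
    module.subspace seq_scale (topspace T) \<and>
    (\<exists>p. frechet_topology_by T p) \<and>
    continuous_map T (product_topology (\<lambda>_. euclidean) UNIV) (\<lambda>x. x)"

definition schauder_basis ::
    "(nat \<Rightarrow> 'k::real_normed_field) topology \<Rightarrow> (nat \<Rightarrow> nat \<Rightarrow> 'k) \<Rightarrow> bool"
  where "schauder_basis T b \<longleftrightarrow>
    (\<forall>n. b n \<in> topspace T) \<and>
    (\<forall>x\<in>topspace T. \<exists>!a. limitin T (\<lambda>N. \<Sum>n<N. seq_scale (a n) (b n)) x sequentially)"

text \<open>If the unit sequences form a basis, an operator \<open>B\<close> as below is determined on \<open>topspace T\<close>
  by \<open>w\<close>; the values of \<open>B\<close> outside \<open>topspace T\<close> and the value \<open>w 0\<close> are irrelevant.\<close>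

definition continuous_weighted_shift ::
    "(nat \<Rightarrow> 'k::real_normed_field) topology \<Rightarrow> (nat \<Rightarrow> 'k) \<Rightarrow> ((nat \<Rightarrow> 'k) \<Rightarrow> nat \<Rightarrow> 'k) \<Rightarrow> bool"
  where "continuous_weighted_shift T w B \<longleftrightarrow>
    (\<forall>x\<in>topspace T. \<forall>y\<in>topspace T. B (x + y) = B x + B y) \<and>
    (\<forall>c. \<forall>x\<in>topspace T. B (seq_scale c x) = seq_scale c (B x)) \<and>
    continuous_map T T B \<and>
    B (unit_seq 0) = 0 \<and>
    (\<forall>n\<ge>1. B (unit_seq n) = seq_scale (w n) (unit_seq (n - 1)))"

definition measure_preserving_system :: "'w measure \<Rightarrow> ('w \<Rightarrow> 'w) \<Rightarrow> bool"
  where "measure_preserving_system M \<tau> \<longleftrightarrow>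
    prob_space M \<and> \<tau> \<in> measurable M M \<and>
    (\<forall>B\<in>sets M. measure M (\<tau> -` B \<inter> space M) = measure M B)"

primrec random_product :: "('w \<Rightarrow> 'w) \<Rightarrow> ('w \<Rightarrow> 'a \<Rightarrow> 'a) \<Rightarrow> nat \<Rightarrow> 'w \<Rightarrow> 'a \<Rightarrow> 'a" where
  "random_product \<tau> T 0 \<omega> = id"
| "random_product \<tau> T (Suc n) \<omega> = T ((\<tau> ^^ n) \<omega>) \<circ> random_product \<tau> T n \<omega>"

definition mixing :: "'a topology \<Rightarrow> (nat \<Rightarrow> 'a \<Rightarrow> 'a) \<Rightarrow> bool"
  where "mixing X S \<longleftrightarrow>
    (\<forall>U V. openin X U \<and> U \<noteq> {} \<and> openin X V \<and> V \<noteq> {} \<longrightarrow>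
      (\<exists>N\<ge>1. \<forall>n\<ge>N. S n ` U \<inter> V \<noteq> {}))"

end

theory Submission imports Defs begin

text \<open>Fix \<open>\<omega>\<close> and let \<open>v i n = \<epsilon> n (\<tau>\<^sup>i \<omega>)\<close>. The \<open>n\<close>-th product sends \<open>e\<^sub>j\<^sub>+\<^sub>n\<close> to \<open>W j n\<close> times \<open>e\<^sub>j\<close>,
  where \<open>W j n = (\<Prod>l=1..n. v (n - l) (j + l))\<close>, and the second assertion says that
  \<open>e\<^sub>n / W 0 n\<close> tends to zero. The equivalence is a statement about any sequence of weights \<open>v\<close>
  without zeros for which each \<open>v i n\<close> is bounded in \<open>i\<close> (\<open>mixing_weighted_products_iff\<close>); along
  an orbit this bound holds because the weights at place \<open>n\<close> are among \<open>w 1 n, \<dots>, w k n\<close>.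

  Suppose that the products are mixing. For large \<open>n\<close> some vector \<open>x\<close> close to zero has an image
  whose coordinate \<open>0\<close>, which is \<open>W 0 n * x n\<close>, exceeds \<open>1\<close> in modulus. Every seminorm of
  \<open>e\<^sub>n / W 0 n\<close> is then at most that of \<open>x n * e\<^sub>n\<close>. The projections \<open>x \<mapsto> x n * e\<^sub>n\<close> tend to zero
  pointwise because the unit sequences form a basis, so by the uniform boundedness principle they
  are equicontinuous (\<open>basis_projections_equicontinuous\<close>) and \<open>x n * e\<^sub>n\<close> is small uniformly in
  \<open>n\<close>. The principle is proved here by a nested ball argument with the seminorms
  (\<open>uniform_boundedness\<close>).

  Conversely, finite sequences are dense. Let \<open>u\<close> and \<open>y\<close> be finite sequences in the given open
  sets. To \<open>u\<close> add the sum of \<open>y m * e\<^sub>m\<^sub>+\<^sub>n / W m n\<close> over \<open>m\<close>. Once \<open>n\<close> exceeds the support of \<open>u\<close>,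
  the product annihilates \<open>u\<close> and maps the sum to \<open>y\<close>. The added vectors tend to zero with
  \<open>e\<^sub>m\<^sub>+\<^sub>n / W 0 (m + n)\<close>, because \<open>W 0 (m + n)\<close> is \<open>W m n\<close> times \<open>m\<close> weights bounded in \<open>n\<close>.\<close>

section \<open>Finite sequences\<close>

interpretation seq: vector_space seq_scale
  by (rule vector_space_seq_scale)

lemma seq_scale_apply [simp]: "seq_scale c x j = c * x j"
  by (simp add: seq_scale_def)

lemma seq_sum_apply: "(\<Sum>i\<in>I. f i :: nat \<Rightarrow> 'k::real_normed_field) j = (\<Sum>i\<in>I. f i j)"
  by (induction I rule: infinite_finite_induct) auto

lemma finite_expansion_apply:
  "(\<Sum>n<N. seq_scale (a n) (unit_seq (n + m))) j = (if m \<le> j \<and> j < N + m then a (j - m) else 0)"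
proof -
  have "(\<Sum>n<N. seq_scale (a n) (unit_seq (n + m))) j = (\<Sum>n<N. if j = n + m then a n else 0)"
    unfolding seq_sum_apply by (intro sum.cong) (auto simp: unit_seq_def)
  also have "\<dots> = (if m \<le> j \<and> j < N + m then a (j - m) else 0)"
  proof (cases "m \<le> j")
    case True
    then have "(\<Sum>n<N. if j = n + m then a n else 0) = (\<Sum>n<N. if j - m = n then a n else 0)"
      by (intro sum.cong) auto
    then show ?thesis
      using True by auto
  qed auto
  finally show ?thesis .
qed

lemma truncation_apply:
  "(\<Sum>n<N. seq_scale (a n) (unit_seq n)) j = (if j < N then a j else 0)"
  using finite_expansion_apply[of a 0 N j] by simp

section \<open>Seminorms on a Frechet sequence space\<close>

locale frechet_seq =
  fixes X :: "(nat \<Rightarrow> 'k::real_normed_field) topology"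
    and p :: "nat \<Rightarrow> (nat \<Rightarrow> 'k) \<Rightarrow> real"
  assumes subspace: "seq.subspace (topspace X)"
    and frechet: "frechet_topology_by X p"
    and continuous_embedding: "continuous_map X (product_topology (\<lambda>_. euclidean) UNIV) (\<lambda>x. x)"
begin

lemmas zero_in = seq.subspace_0[OF subspace]
  and add_in = seq.subspace_add[OF subspace]
  and diff_in = seq.subspace_diff[OF subspace]
  and scale_in = seq.subspace_scale[OF subspace]
  and sum_in = seq.subspace_sum[OF subspace]

lemma seminorm: "seminorm_on (topspace X) (p m)"
  using frechet by (simp add: frechet_topology_by_def)

lemma seminorm_increasing: "x \<in> topspace X \<Longrightarrow> m \<le> n \<Longrightarrow> p m x \<le> p n x"
  using frechet by (auto simp: frechet_topology_by_def mono_def)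

lemma openin_iff_seminorm_ball: "openin X U \<longleftrightarrow>
    U \<subseteq> topspace X \<and> (\<forall>x\<in>U. \<exists>n. \<exists>r>0. {y \<in> topspace X. p n (y - x) < r} \<subseteq> U)"
  using frechet unfolding frechet_topology_by_def by (elim conjE) (erule allE[of _ U])

lemma complete:
  assumes "\<And>i. x i \<in> topspace X"
    and "\<And>n \<epsilon>. \<epsilon> > 0 \<Longrightarrow> \<exists>N::nat. \<forall>i\<ge>N. \<forall>j\<ge>N. p n (x i - x j) < \<epsilon>"
  obtains y where "limitin X x y sequentially"
proof -
  have "(\<forall>i. x i \<in> topspace X) \<and>
      (\<forall>n. \<forall>\<epsilon>>0. \<exists>N::nat. \<forall>i\<ge>N. \<forall>j\<ge>N. p n (x i - x j) < \<epsilon>) \<longrightarrow>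
      (\<exists>y. limitin X x y sequentially)"
    using frechet unfolding frechet_topology_by_def by (elim conjE) (erule allE[of _ x])
  then show thesis
    using assms that by presburger
qed

lemma
  assumes "seminorm_on (topspace X) q"
  shows seminorm_nonneg: "x \<in> topspace X \<Longrightarrow> 0 \<le> q x"
    and seminorm_triangle: "x \<in> topspace X \<Longrightarrow> y \<in> topspace X \<Longrightarrow> q (x + y) \<le> q x + q y"
    and seminorm_scale: "x \<in> topspace X \<Longrightarrow> q (seq_scale c x) = norm c * q x"
  using assms by (auto simp: seminorm_on_def)

lemma seminorm_zero:
  assumes "seminorm_on (topspace X) q"
  shows "q 0 = 0"
proof -
  have "q (seq_scale 0 0) = 0"
    using seminorm_scale[OF assms zero_in, of 0] by simp
  moreover have "seq_scale 0 0 = (0 :: nat \<Rightarrow> 'k)"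
    by (simp add: fun_eq_iff)
  ultimately show ?thesis
    by simp
qed

lemma seminorm_minus:
  assumes "seminorm_on (topspace X) q" "x \<in> topspace X"
  shows "q (- x) = q x"
proof -
  have "- x = seq_scale (- 1) x"
    by (simp add: fun_eq_iff)
  then show ?thesis
    using seminorm_scale[OF assms, of "- 1"] by simp
qed

lemma seminorm_minus_commute:
  assumes "seminorm_on (topspace X) q" "x \<in> topspace X" "y \<in> topspace X"
  shows "q (x - y) = q (y - x)"
  using seminorm_minus[OF assms(1) diff_in[OF assms(2,3)]] by simp

lemma seminorm_diff_triangle:
  assumes "seminorm_on (topspace X) q" "x \<in> topspace X" "y \<in> topspace X" "z \<in> topspace X"
  shows "q (x - z) \<le> q (x - y) + q (y - z)"
  using seminorm_triangle[OF assms(1) diff_in[OF assms(2,3)] diff_in[OF assms(3,4)]] by simp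

lemma seminorm_sum:
  assumes "seminorm_on (topspace X) q" "\<And>i. i \<in> I \<Longrightarrow> f i \<in> topspace X"
  shows "q (\<Sum>i\<in>I. f i) \<le> (\<Sum>i\<in>I. q (f i))"
  using assms(2)
proof (induction I rule: infinite_finite_induct)
  case (insert i I)
  then have "q (f i + sum f I) \<le> q (f i) + q (sum f I)"
    by (intro seminorm_triangle assms(1) sum_in) auto
  moreover have "q (sum f I) \<le> (\<Sum>i\<in>I. q (f i))"
    using insert by simp
  ultimately show ?case
    unfolding sum.insert[OF insert.hyps] by linarith
qed (simp_all add: seminorm_zero[OF assms(1)])

lemma openin_seminorm_ball:
  assumes x: "x \<in> topspace X"
  shows "openin X {y \<in> topspace X. p m (y - x) < r}"
  unfolding openin_iff_seminorm_ball
proof (intro conjI ballI)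
  fix y assume y: "y \<in> {y \<in> topspace X. p m (y - x) < r}"
  have "p m (z - x) < r" if "z \<in> topspace X" "p m (z - y) < r - p m (y - x)" for z
    using seminorm_diff_triangle[OF seminorm, of z y x m] x y that by auto
  with y show "\<exists>n. \<exists>s>0. {z \<in> topspace X. p n (z - y) < s} \<subseteq> {y \<in> topspace X. p m (y - x) < r}"
    by (intro exI[of _ m] exI[of _ "r - p m (y - x)"]) auto
qed auto

lemma limitin_iff_seminorms:
  assumes "\<And>i. x i \<in> topspace X"
  shows "limitin X x y F \<longleftrightarrow> y \<in> topspace X \<and> (\<forall>m. ((\<lambda>i. p m (x i - y)) \<longlongrightarrow> 0) F)"
proof (intro iffI conjI allI)
  assume lim: "limitin X x y F"
  then show y: "y \<in> topspace X"
    by (rule limitin_topspace)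
  fix m
  show "((\<lambda>i. p m (x i - y)) \<longlongrightarrow> 0) F"
  proof (rule tendstoI)
    fix e :: real assume "e > 0"
    then have "\<forall>\<^sub>F i in F. x i \<in> {z \<in> topspace X. p m (z - y) < e}"
      using lim y by (intro limitinD[OF lim] openin_seminorm_ball)
        (auto simp: seminorm_zero[OF seminorm])
    then show "\<forall>\<^sub>F i in F. dist (p m (x i - y)) 0 < e"
      by eventually_elim (auto simp: seminorm_nonneg[OF seminorm] diff_in y)
  qed
next
  assume y: "y \<in> topspace X \<and> (\<forall>m. ((\<lambda>i. p m (x i - y)) \<longlongrightarrow> 0) F)"
  show "limitin X x y F"
    unfolding limitin_def
  proof (intro conjI allI impI)
    fix U assume "openin X U \<and> y \<in> U"
    then obtain m r where r: "r > 0" "{z \<in> topspace X. p m (z - y) < r} \<subseteq> U"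
      unfolding openin_iff_seminorm_ball by blast
    have "\<forall>\<^sub>F i in F. p m (x i - y) < r"
      using y \<open>r > 0\<close> by (intro order_tendstoD) auto
    then show "\<forall>\<^sub>F i in F. x i \<in> U"
      by eventually_elim (use r assms in auto)
  qed (use y in auto)
qed

lemma continuous_map_coordinate: "continuous_map X euclidean (\<lambda>x. x j)"
  using continuous_embedding by (simp add: continuous_map_componentwise_UNIV)

lemma limitin_coordinate:
  "limitin X x y F \<Longrightarrow> ((\<lambda>i. x i j) \<longlongrightarrow> y j) F"
  using continuous_map_limit[OF continuous_map_coordinate, of x y F j]
  by (simp add: o_def)

text \<open>A coordinate functional is bounded by \<open>1\<close> on some ball, because the embedding into the
  product is continuous at \<open>0\<close>; homogeneity turns this into an estimate by a seminorm.\<close>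

lemma coordinate_bound:
  obtains m C where "C > 0" "\<And>x. x \<in> topspace X \<Longrightarrow> norm (x j) \<le> C * p m x"
proof -
  have "openin X {x \<in> topspace X. x j \<in> ball 0 1}"
    by (rule openin_continuous_map_preimage[OF continuous_map_coordinate]) auto
  moreover have "0 \<in> {x \<in> topspace X. x j \<in> ball 0 1}"
    by (simp add: zero_in)
  ultimately obtain m r where r: "r > 0"
    and "{y \<in> topspace X. p m (y - 0) < r} \<subseteq> {x \<in> topspace X. x j \<in> ball 0 1}"
    unfolding openin_iff_seminorm_ball by blast
  then have small: "norm (x j) < 1" if "x \<in> topspace X" "p m x < r" for x
    using that by auto
  show thesis
  proof
    show "1 / r > 0" using r by simp
    fix x assume x: "x \<in> topspace X"
    show "norm (x j) \<le> 1 / r * p m x"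
    proof (rule ccontr)
      assume "\<not> ?thesis"
      then have "p m x < r * norm (x j)"
        using r by (simp add: field_simps)
      moreover from this have "norm (x j) > 0"
        using r seminorm_nonneg[OF seminorm x, of m] by (smt (verit) mult_nonneg_nonpos)
      moreover have "p m (seq_scale (inverse (x j)) x) = p m x / norm (x j)"
        by (simp add: seminorm_scale[OF seminorm x] norm_inverse divide_inverse mult.commute)
      ultimately have "p m (seq_scale (inverse (x j)) x) < r"
        by (simp add: pos_divide_less_eq)
      from small[OF scale_in[OF x] this] \<open>norm (x j) > 0\<close> show False
        by simp
    qed
  qed
qed

text \<open>The uniform boundedness principle. If the family is not dominated by a multiple of any
  seminorm, then every closed ball contains a smaller closed ball on which some \<open>q n\<close> exceeds a
  prescribed constant: near the centre \<open>s\<close> there is a small \<open>x\<close> with \<open>q n x\<close> large, and \<open>q n\<close> is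
  large at \<open>s + x\<close> or at \<open>s - x\<close>, because twice \<open>x\<close> is their difference. The point common to a
  nested sequence of such balls contradicts pointwise boundedness.\<close>

lemma uniform_boundedness:
  fixes q :: "'i \<Rightarrow> (nat \<Rightarrow> 'k) \<Rightarrow> real"
  assumes q: "\<And>n. seminorm_on (topspace X) (q n)"
    and q_cont: "\<And>n. \<exists>m C. \<forall>x\<in>topspace X. q n x \<le> C * p m x"
    and q_bdd: "\<And>x. x \<in> topspace X \<Longrightarrow> \<exists>K. \<forall>n. q n x \<le> K"
  obtains m C where "C > 0" "\<And>n x. x \<in> topspace X \<Longrightarrow> q n x \<le> C * p m x"
proof (rule ccontr)
  assume "\<not> thesis"
  with that have no_bound: "\<exists>n. \<exists>x\<in>topspace X. q n x > C * p m x" if "C > 0" for C m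
    using \<open>C > 0\<close> by (meson not_le)
  have large: "\<exists>n. \<exists>x\<in>topspace X. p m x < \<delta> \<and> q n x > R" if "\<delta> > 0" "R \<ge> 0" for m \<delta> R
  proof -
    have "(R + 1) / \<delta> > 0"
      using that by simp
    from no_bound[OF this] obtain n x
      where x: "x \<in> topspace X" "q n x > (R + 1) / \<delta> * p m x"
      by blast
    have "(R + 1) / \<delta> * p m x \<ge> 0"
      using seminorm_nonneg[OF seminorm x(1)] that by simp
    with x have pos: "q n x > 0"
      by linarith
    \<comment> \<open>Rescale \<open>x\<close> so that \<open>q n\<close> takes the value \<open>R + 1\<close>.\<close>
    define t :: 'k where "t = of_real ((R + 1) / q n x)"
    have t: "norm t = (R + 1) / q n x"
      unfolding t_def norm_of_real using pos that by simp
    have "p m (seq_scale t x) < \<delta>"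
      using x pos that by (simp add: seminorm_scale[OF seminorm] t field_simps)
    moreover have "q n (seq_scale t x) > R"
      using x pos by (simp add: seminorm_scale[OF q] t)
    ultimately show ?thesis
      using scale_in[OF x(1)] by blast
  qed
  define cb where "cb = (\<lambda>(s, m, r). {y \<in> topspace X. p m (y - s) \<le> r})"
  \<comment> \<open>Radii of at most \<open>(1/2) ^ i\<close> in a seminorm of index at least \<open>i\<close> make the centres Cauchy.\<close>
  define good where
    "good = (\<lambda>(i::nat) (s, m, r). s \<in> topspace X \<and> i \<le> m \<and> 0 < (r::real) \<and> r \<le> (1/2) ^ i)"
  have "\<exists>b. \<forall>i. good i (b i) \<and>
      (cb (b (Suc i)) \<subseteq> cb (b i) \<and> (\<forall>z\<in>cb (b (Suc i)). \<exists>n. q n z > real i))"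
  proof (rule dependent_nat_choice)
    show "\<exists>b. good 0 b"
      by (rule exI[of _ "(0, 0, 1)"]) (simp add: good_def zero_in)
  next
    fix b and i assume b: "good i b"
    obtain s m r where [simp]: "b = (s, m, r)"
      by (cases b)
    from b have s: "s \<in> topspace X" "i \<le> m" "0 < r" "r \<le> (1/2) ^ i"
      by (auto simp: good_def)
    obtain n x where x: "x \<in> topspace X" "p m x < r / 2" "q n x > real i + 1"
      using large[of "r / 2" "real i + 1" m] s by auto
    have "\<exists>s'\<in>topspace X. p m (s' - s) < r / 2 \<and> q n s' > real i + 1"
    proof -
      have "2 * q n x = q n (seq_scale 2 x)"
        by (simp add: seminorm_scale[OF q x(1)])
      also have "seq_scale 2 x = (s + x) - (s - x)"
        by (simp add: fun_eq_iff)
      also have "q n ((s + x) - (s - x)) \<le> q n (s + x) + q n (s - x)"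
        using seminorm_triangle[OF q, of "s + x" "- (s - x)" n]
          seminorm_minus[OF q, of "s - x" n] s x by (simp add: add_in diff_in)
      finally consider "q n (s + x) > real i + 1" | "q n (s - x) > real i + 1"
        using x by linarith
      then show ?thesis
      proof cases
        case 1
        then show ?thesis
          using s x by (intro bexI[of _ "s + x"]) (auto simp: add_in)
      next
        case 2
        then show ?thesis
          using s x seminorm_minus[OF seminorm x(1), of m]
          by (intro bexI[of _ "s - x"]) (auto simp: diff_in)
      qed
    qed
    then obtain s' where s': "s' \<in> topspace X" "p m (s' - s) < r / 2" "q n s' > real i + 1"
      by blast
    obtain m0 C where C: "\<forall>x\<in>topspace X. q n x \<le> C * p m0 x"
      using q_cont by blast
    \<comment> \<open>The seminorm of index \<open>m0\<close> controls \<open>q n\<close>; taking \<open>m' > m\<close> makes the index grow with \<open>i\<close>.\<close>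
    define m' where "m' = max (Suc m) m0"
    \<comment> \<open>On the new ball \<open>q n\<close> falls below its value at the centre by at most \<open>\<bar>C\<bar> * r' \<le> 1\<close>.\<close>
    define r' where "r' = min (r / 2) (1 / (\<bar>C\<bar> + 1))"
    have r': "0 < r'" "r' \<le> r / 2" "\<bar>C\<bar> * r' \<le> 1"
    proof -
      show "0 < r'" "r' \<le> r / 2"
        using s by (auto simp: r'_def)
      have "\<bar>C\<bar> * r' \<le> \<bar>C\<bar> * (1 / (\<bar>C\<bar> + 1))"
        by (intro mult_left_mono) (auto simp: r'_def)
      also have "\<dots> \<le> 1"
        by simp
      finally show "\<bar>C\<bar> * r' \<le> 1" .
    qed
    have "m \<le> m'" "m0 \<le> m'"
      by (auto simp: m'_def)
    have inside: "p m (z - s) \<le> r \<and> q n z > real i"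
      if z: "z \<in> topspace X" "p m' (z - s') \<le> r'" for z
    proof
      have "p m (z - s') \<le> r'" "p m0 (z - s') \<le> r'"
        using seminorm_increasing[OF diff_in[OF z(1) s'(1)] \<open>m \<le> m'\<close>]
          seminorm_increasing[OF diff_in[OF z(1) s'(1)] \<open>m0 \<le> m'\<close>] z(2) by linarith+
      then show "p m (z - s) \<le> r"
        using seminorm_diff_triangle[OF seminorm z(1) s'(1) s(1), of m] s' r' by linarith
      have "q n s' \<le> q n z + q n (s' - z)"
        using seminorm_triangle[OF q z(1) diff_in[OF s'(1) z(1)], of n] by simp
      moreover have "q n (s' - z) \<le> C * p m0 (s' - z)"
        using C diff_in[OF s'(1) z(1)] by blast
      moreover have "C * p m0 (s' - z) \<le> \<bar>C\<bar> * r'"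
        using \<open>p m0 (z - s') \<le> r'\<close> seminorm_minus_commute[OF seminorm z(1) s'(1), of m0]
          seminorm_nonneg[OF seminorm diff_in[OF s'(1) z(1)], of m0]
        by (intro mult_mono) auto
      ultimately show "q n z > real i"
        using s' r' by linarith
    qed
    have "good (Suc i) (s', m', r')"
      using s s' r' by (auto simp: good_def m'_def)
    with inside show "\<exists>b'. good (Suc i) b' \<and> cb b' \<subseteq> cb b \<and> (\<forall>z\<in>cb b'. \<exists>n. q n z > real i)"
      by (intro exI[of _ "(s', m', r')"]) (auto simp: cb_def)
  qed
  then obtain b where b_chain: "\<forall>i. good i (b i) \<and>
      (cb (b (Suc i)) \<subseteq> cb (b i) \<and> (\<forall>z\<in>cb (b (Suc i)). \<exists>n. q n z > real i))" ..
  then have b: "good i (b i)" "cb (b (Suc i)) \<subseteq> cb (b i)"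
    "z \<in> cb (b (Suc i)) \<Longrightarrow> \<exists>n. q n z > real i" for i z
    using b_chain[rule_format, of i] by simp_all
  define s where "s i = fst (b i)" for i
  define m where "m i = fst (snd (b i))" for i
  define r where "r i = snd (snd (b i))" for i
  have b_eq: "b i = (s i, m i, r i)" for i
    by (simp add: s_def m_def r_def)
  have s: "s i \<in> topspace X" "i \<le> m i" "0 < r i" "r i \<le> (1/2) ^ i" for i
    using b(1)[of i] by (auto simp: good_def b_eq)
  have nested: "cb (b j) \<subseteq> cb (b i)" if "i \<le> j" for i j
    by (rule lift_Suc_antimono_le[of "\<lambda>i. cb (b i)", OF b(2) that])
  have centre: "p (m i) (s j - s i) \<le> r i" if "i \<le> j" for i j
  proof -
    have "s j \<in> cb (b j)"
      using s[of j] by (simp add: cb_def b_eq seminorm_zero[OF seminorm])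
    with nested[OF that] show ?thesis
      by (auto simp: cb_def b_eq)
  qed
  obtain y where y: "limitin X s y sequentially"
  proof (rule complete[of s])
    show "s i \<in> topspace X" for i
      by (rule s)
    fix n and e :: real assume "e > 0"
    then obtain N0 where N0: "(1/2) ^ N0 < e / 2"
      using real_arch_pow_inv[of "e / 2" "1/2"] by auto
    define N where "N = max N0 n"
    have "(1/2) ^ N \<le> ((1/2) ^ N0 :: real)"
      by (intro power_decreasing) (auto simp: N_def)
    with N0 s(4)[of N] have rN: "r N < e / 2"
      by linarith
    have close: "p n (s i - s N) < e / 2" if "i \<ge> N" for i
      using seminorm_increasing[OF diff_in[OF s(1) s(1)], of n "m N" i N] centre[OF that] rN
        s(2)[of N] by (simp add: N_def)
    have "p n (s i - s j) < e" if "i \<ge> N" "j \<ge> N" for i j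
      using seminorm_diff_triangle[OF seminorm s(1) s(1) s(1), of n i j N] close[OF that(1)]
        close[OF that(2)] seminorm_minus_commute[OF seminorm s(1) s(1), of n N j] by linarith
    then show "\<exists>N. \<forall>i\<ge>N. \<forall>j\<ge>N. p n (s i - s j) < e"
      by blast
  qed
  then have y': "y \<in> topspace X" "\<And>m. (\<lambda>i. p m (s i - y)) \<longlonglongrightarrow> 0"
    using limitin_iff_seminorms[of s y] s by auto
  have "y \<in> cb (b i)" for i
  proof -
    have "p (m i) (y - s i) \<le> 0 + r i"
    proof (rule tendsto_lowerbound)
      show "(\<lambda>j. p (m i) (s j - y) + r i) \<longlonglongrightarrow> 0 + r i"
        by (intro tendsto_intros y')
      show "\<forall>\<^sub>F j in sequentially. p (m i) (y - s i) \<le> p (m i) (s j - y) + r i"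
        using eventually_ge_at_top[of i]
      proof eventually_elim
        case (elim j)
        then show ?case
          using seminorm_diff_triangle[OF seminorm y'(1) s(1) s(1), of "m i" i j] centre[OF elim]
            seminorm_minus_commute[OF seminorm y'(1) s(1), of "m i" j] by linarith
      qed
    qed simp
    with y' show ?thesis
      by (simp add: cb_def b_eq)
  qed
  then have exceeds: "\<exists>n. q n y > real i" for i
    by (rule b(3))
  obtain K where K: "q n y \<le> K" for n
    using q_bdd[OF y'(1)] by blast
  obtain i where i: "K \<le> real i"
    using real_arch_simple by blast
  obtain n where n: "q n y > real i"
    using exceeds by blast
  show False
    using K[of n] i n by linarith
qed

end

section \<open>Expansion in the unit sequences\<close>

locale frechet_unit_basis = frechet_seq X p
  for X :: "(nat \<Rightarrow> 'k::real_normed_field) topology" and p +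
  assumes basis: "schauder_basis X unit_seq"
begin

lemma unit_seq_in: "unit_seq n \<in> topspace X"
  using basis by (simp add: schauder_basis_def)

lemma truncation_in: "(\<Sum>n<N. seq_scale (a n) (unit_seq n)) \<in> topspace X"
  by (intro sum_in scale_in unit_seq_in)

text \<open>The coefficients in the expansion of \<open>x\<close> can only be its coordinates, since convergence in
  \<open>X\<close> is coordinatewise.\<close>

lemma truncations_converge:
  assumes "x \<in> topspace X"
  shows "limitin X (\<lambda>N. \<Sum>n<N. seq_scale (x n) (unit_seq n)) x sequentially"
proof -
  obtain a where a: "limitin X (\<lambda>N. \<Sum>n<N. seq_scale (a n) (unit_seq n)) x sequentially"
    using basis assms by (auto simp: schauder_basis_def)
  have "a j = x j" for j
  proof (rule LIMSEQ_unique)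
    show "(\<lambda>N. (\<Sum>n<N. seq_scale (a n) (unit_seq n)) j) \<longlonglongrightarrow> x j"
      by (rule limitin_coordinate[OF a])
    show "(\<lambda>N. (\<Sum>n<N. seq_scale (a n) (unit_seq n)) j) \<longlonglongrightarrow> a j"
      by (rule tendsto_eventually)
        (use eventually_gt_at_top[of j] in \<open>eventually_elim, simp add: truncation_apply\<close>)
  qed
  then have "a = x" ..
  with a show ?thesis
    by simp
qed

lemma open_contains_truncation:
  assumes "openin X U" "U \<noteq> {}"
  obtains x N where "(\<Sum>n<N. seq_scale (x n) (unit_seq n)) \<in> U"
proof -
  obtain x where "x \<in> U"
    using assms by blast
  then have "\<forall>\<^sub>F N in sequentially. (\<Sum>n<N. seq_scale (x n) (unit_seq n)) \<in> U"
    using assms openin_subset by (intro limitinD[OF truncations_converge]) auto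
  then show thesis
    using that by (auto simp: eventually_sequentially)
qed

lemma basis_terms_tendsto_zero:
  assumes "x \<in> topspace X"
  shows "(\<lambda>n. norm (x n) * p m (unit_seq n)) \<longlonglongrightarrow> 0"
proof -
  define S where "S N = (\<Sum>n<N. seq_scale (x n) (unit_seq n))" for N
  have S: "S N \<in> topspace X" for N
    unfolding S_def by (rule truncation_in)
  have lim: "(\<lambda>N. p m (S N - x)) \<longlonglongrightarrow> 0"
    using truncations_converge[OF assms] limitin_iff_seminorms[of S x sequentially] S
    by (auto simp: S_def[abs_def])
  have "(\<lambda>N. p m (S (Suc N) - x) + p m (S N - x)) \<longlonglongrightarrow> 0 + 0"
    by (intro tendsto_add LIMSEQ_Suc lim)
  then have bound: "(\<lambda>N. p m (S (Suc N) - x) + p m (S N - x)) \<longlonglongrightarrow> 0"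
    by simp
  show ?thesis
  proof (rule tendsto_sandwich[OF _ _ tendsto_const bound])
    show "\<forall>\<^sub>F N in sequentially. 0 \<le> norm (x N) * p m (unit_seq N)"
      by (simp add: seminorm_nonneg[OF seminorm] unit_seq_in)
    have "norm (x N) * p m (unit_seq N) = p m (S (Suc N) - S N)" for N
      by (simp add: S_def seminorm_scale[OF seminorm] unit_seq_in)
    also have "p m (S (Suc N) - S N) \<le> p m (S (Suc N) - x) + p m (S N - x)" for N
      using seminorm_diff_triangle[OF seminorm S assms S]
        seminorm_minus_commute[OF seminorm S assms] by (metis (no_types))
    finally show "\<forall>\<^sub>F N in sequentially.
        norm (x N) * p m (unit_seq N) \<le> p m (S (Suc N) - x) + p m (S N - x)"
      by simp
  qed
qed

text \<open>The projections onto the basis vectors are equicontinuous: at each point they tend to zero,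
  hence are bounded there, and uniform boundedness applies.\<close>

lemma basis_projections_equicontinuous:
  obtains m C where "C > 0"
    "\<And>n x. x \<in> topspace X \<Longrightarrow> norm (x n) * p j (unit_seq n) \<le> C * p m x"
proof (rule uniform_boundedness[of "\<lambda>n x. norm (x n) * p j (unit_seq n)"])
  have nonneg: "p j (unit_seq n) \<ge> 0" for n
    by (rule seminorm_nonneg[OF seminorm unit_seq_in])
  show "seminorm_on (topspace X) (\<lambda>x. norm (x n) * p j (unit_seq n))" for n
    unfolding seminorm_on_def
  proof (intro conjI ballI allI)
    fix x y :: "nat \<Rightarrow> 'k"
    have "norm ((x + y) n) * p j (unit_seq n) \<le> (norm (x n) + norm (y n)) * p j (unit_seq n)"
      using nonneg by (intro mult_right_mono) (auto simp: norm_triangle_ineq)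
    then show "norm ((x + y) n) * p j (unit_seq n)
        \<le> norm (x n) * p j (unit_seq n) + norm (y n) * p j (unit_seq n)"
      by (simp add: algebra_simps)
  qed (use nonneg in \<open>auto simp: norm_mult\<close>)
  show "\<exists>m C. \<forall>x\<in>topspace X. norm (x n) * p j (unit_seq n) \<le> C * p m x" for n
  proof -
    obtain m C where C: "\<And>x. x \<in> topspace X \<Longrightarrow> norm (x n) \<le> C * p m x"
      using coordinate_bound[of n] by metis
    have "norm (x n) * p j (unit_seq n) \<le> (C * p j (unit_seq n)) * p m x"
      if "x \<in> topspace X" for x
      using mult_right_mono[OF C[OF that] nonneg[of n]] by (simp add: mult_ac)
    then show ?thesis
      by blast
  qed
  show "\<exists>K. \<forall>n. norm (x n) * p j (unit_seq n) \<le> K" if "x \<in> topspace X" for x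
  proof -
    have "Bseq (\<lambda>n. norm (x n) * p j (unit_seq n))"
      using basis_terms_tendsto_zero[OF that] by (intro convergent_imp_Bseq convergentI)
    then obtain K where "\<And>n. norm (norm (x n) * p j (unit_seq n)) \<le> K"
      by (auto simp: Bseq_def)
    then show ?thesis
      by (metis abs_le_D1 real_norm_def)
  qed
qed (use that in blast)

section \<open>Products of weighted shifts\<close>

lemma mixingD:
  assumes "mixing X S" "openin X U" "U \<noteq> {}" "openin X V" "V \<noteq> {}"
  shows "\<exists>N. \<forall>n\<ge>N. \<exists>x\<in>U. S n x \<in> V"
proof -
  obtain N where "\<forall>n\<ge>N. S n ` U \<inter> V \<noteq> {}"
    using assms unfolding mixing_def by blast
  then show ?thesis
    by blast
qed

text \<open>The formula holds on finite sequences by linearity and extends to \<open>X\<close> because both \<open>B\<close> and the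
  coordinate functionals are continuous.\<close>

lemma weighted_shift_apply:
  assumes B: "continuous_weighted_shift X w B" and x: "x \<in> topspace X"
  shows "B x j = w (Suc j) * x (Suc j)"
proof (rule LIMSEQ_unique)
  let ?S = "\<lambda>N. \<Sum>n<N. seq_scale (x n) (unit_seq n)"
  have B_add: "B (u + v) = B u + B v" if "u \<in> topspace X" "v \<in> topspace X" for u v
    using B that by (auto simp: continuous_weighted_shift_def)
  have B_scale: "B (seq_scale c u) = seq_scale c (B u)" if "u \<in> topspace X" for c u
    using B that by (auto simp: continuous_weighted_shift_def)
  have B_unit: "B (unit_seq n) = (if n = 0 then 0 else seq_scale (w n) (unit_seq (n - 1)))" for n
    using B by (auto simp: continuous_weighted_shift_def)
  have B_zero: "B 0 = 0"
    using B_add[OF zero_in zero_in] by simp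
  have "limitin X (B \<circ> ?S) (B x) sequentially"
    using B by (intro continuous_map_limit[OF _ truncations_converge[OF x]])
      (simp add: continuous_weighted_shift_def)
  from limitin_coordinate[OF this] show "(\<lambda>N. B (?S N) j) \<longlonglongrightarrow> B x j"
    by (simp add: o_def)
  have "B (?S N) j = (if Suc j < N then w (Suc j) * x (Suc j) else 0)" for N
  proof (induction N)
    case 0
    show ?case
      unfolding lessThan_0 sum.empty B_zero by simp
  next
    case (Suc N)
    have "B (?S (Suc N)) = B (?S N) + seq_scale (x N) (B (unit_seq N))"
      using B_add[OF truncation_in scale_in[OF unit_seq_in]] B_scale[OF unit_seq_in]
      unfolding sum.lessThan_Suc by metis
    then have step: "B (?S (Suc N)) j = B (?S N) j + x N * B (unit_seq N) j"
      by simp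
    have unit: "B (unit_seq N) j = (if N = Suc j then w N else 0)"
      unfolding B_unit by (auto simp: unit_seq_def)
    show ?case
      unfolding step unit Suc.IH by (cases "N = Suc j") auto
  qed
  then show "(\<lambda>N. B (?S N) j) \<longlonglongrightarrow> w (Suc j) * x (Suc j)"
    by (intro tendsto_eventually)
      (use eventually_gt_at_top[of "Suc j"] in \<open>eventually_elim, simp\<close>)
qed

text \<open>The equivalence for an arbitrary non-autonomous family of weights; the operators enter through
  the coordinate formula for their products. The bound on the weights serves to compare
  \<open>W 0 (n + m)\<close> with \<open>W m n\<close>: their ratio is the product of the weights at the places \<open>1, \<dots>, m\<close>
  of the last \<open>m\<close> operators, which change with \<open>n\<close>.\<close>

theorem mixing_weighted_products_iff:
  fixes v :: "nat \<Rightarrow> nat \<Rightarrow> 'k" and S :: "nat \<Rightarrow> (nat \<Rightarrow> 'k) \<Rightarrow> nat \<Rightarrow> 'k"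
  assumes nonzero: "\<And>i n. n \<ge> 1 \<Longrightarrow> v i n \<noteq> 0"
    and bounded: "\<And>n. n \<ge> 1 \<Longrightarrow> bounded (range (\<lambda>i. v i n))"
    and S: "\<And>n x j. x \<in> topspace X \<Longrightarrow> S n x j = (\<Prod>l=1..n. v (n - l) (j + l)) * x (j + n)"
  shows "mixing X S \<longleftrightarrow>
    limitin X (\<lambda>n. seq_scale (inverse (\<Prod>l=1..n. v (n - l) l)) (unit_seq n)) 0 sequentially"
proof -
  define W where "W j n = (\<Prod>l=1..n. v (n - l) (j + l))" for j n
  have W_nonzero: "W j n \<noteq> 0" for j n
    by (auto simp: W_def nonzero)
  have S_W: "S n x j = W j n * x (j + n)" if "x \<in> topspace X" for n x j
    using S[OF that] by (simp add: W_def)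
  have limit_iff: "limitin X (\<lambda>n. seq_scale (inverse (W 0 n)) (unit_seq n)) 0 sequentially \<longleftrightarrow>
      (\<forall>j. (\<lambda>n. norm (inverse (W 0 n)) * p j (unit_seq n)) \<longlonglongrightarrow> 0)"
    by (subst limitin_iff_seminorms)
      (simp_all add: scale_in unit_seq_in zero_in seminorm_scale[OF seminorm])
  have "mixing X S \<longleftrightarrow> (\<forall>j. (\<lambda>n. norm (inverse (W 0 n)) * p j (unit_seq n)) \<longlonglongrightarrow> 0)"
  proof (intro iffI allI)
    fix j assume mix: "mixing X S"
    obtain m C where C: "C > 0"
      "\<And>n x. x \<in> topspace X \<Longrightarrow> norm (x n) * p j (unit_seq n) \<le> C * p m x"
      using basis_projections_equicontinuous[of j] by metis
    have nonneg: "p j (unit_seq n) \<ge> 0" for n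
      by (rule seminorm_nonneg[OF seminorm unit_seq_in])
    show "(\<lambda>n. norm (inverse (W 0 n)) * p j (unit_seq n)) \<longlonglongrightarrow> 0"
    proof (rule LIMSEQ_I)
      fix e :: real assume "e > 0"
      \<comment> \<open>\<open>V\<close> stays away from zero in coordinate \<open>0\<close>; it contains \<open>2 e\<^sub>0\<close>.\<close>
      define U where "U = {x \<in> topspace X. p m (x - 0) < e / C}"
      define V where "V = {x \<in> topspace X. x 0 \<in> - cball 0 1}"
      have "openin X U"
        unfolding U_def by (rule openin_seminorm_ball[OF zero_in])
      moreover have "0 \<in> U"
        using \<open>e > 0\<close> C by (simp add: U_def zero_in seminorm_zero[OF seminorm])
      moreover have "openin X V"
        unfolding V_def by (rule openin_continuous_map_preimage[OF continuous_map_coordinate])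
          (simp add: open_Compl)
      moreover have "seq_scale 2 (unit_seq 0) \<in> V"
        by (simp add: V_def scale_in unit_seq_in) (simp add: unit_seq_def)
      ultimately obtain N where N: "\<exists>x\<in>U. S n x \<in> V" if "n \<ge> N" for n
        using mixingD[OF mix, of U V] by (metis empty_iff)
      have "norm (norm (inverse (W 0 n)) * p j (unit_seq n) - 0) < e" if n: "n \<ge> N" for n
      proof -
        obtain x where x: "x \<in> topspace X" "p m x < e / C" "norm (S n x 0) > 1"
          using N[OF n] by (auto simp: U_def V_def)
        have "norm (W 0 n) * norm (x n) > 1"
          using x S_W[OF x(1), of n 0] by (simp add: norm_mult)
        then have "1 / norm (W 0 n) \<le> norm (x n)"
          using W_nonzero[of 0 n] by (simp add: pos_divide_le_eq mult.commute)
        then have "norm (inverse (W 0 n)) \<le> norm (x n)"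
          by (simp add: norm_inverse divide_inverse)
        then have "norm (inverse (W 0 n)) * p j (unit_seq n) \<le> norm (x n) * p j (unit_seq n)"
          using nonneg by (intro mult_right_mono) auto
        also have "\<dots> \<le> C * p m x"
          using C x by blast
        also have "\<dots> < e"
          using C x by (simp add: field_simps)
        finally show ?thesis
          using nonneg by (simp add: abs_mult)
      qed
      then show "\<exists>N. \<forall>n\<ge>N. norm (norm (inverse (W 0 n)) * p j (unit_seq n) - 0) < e"
        by blast
    qed
  next
    assume lim: "\<forall>j. (\<lambda>n. norm (inverse (W 0 n)) * p j (unit_seq n)) \<longlonglongrightarrow> 0"
    have W_shift: "W 0 (n + m) = (\<Prod>l=1..m. v (n + m - l) l) * W m n" for m n
    proof -
      have "W 0 (n + m) = (\<Prod>l\<in>{1..m} \<union> {m+1..n+m}. v (n + m - l) l)"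
        unfolding W_def by (intro prod.cong) auto
      also have "\<dots> = (\<Prod>l=1..m. v (n + m - l) l) * (\<Prod>l=m+1..n+m. v (n + m - l) l)"
        by (intro prod.union_disjoint) auto
      also have "(\<Prod>l=m+1..n+m. v (n + m - l) l) = W m n"
        unfolding W_def
        by (rule prod.reindex_bij_witness[of _ "\<lambda>l. m + l" "\<lambda>l. l - m"]) auto
      finally show ?thesis .
    qed
    have lim_W: "(\<lambda>n. norm (inverse (W m n)) * p j (unit_seq (n + m))) \<longlonglongrightarrow> 0" for m j
    proof -
      have "\<exists>b. \<forall>i. norm (v i l) \<le> b" if "l \<ge> 1" for l
        using bounded[OF that] by (auto simp: bounded_iff)
      then obtain b where b: "\<And>i l. l \<ge> 1 \<Longrightarrow> norm (v i l) \<le> b l"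
        by metis
      have nonneg: "norm c * p j (unit_seq n) \<ge> 0" for c :: 'k and n
        by (simp add: seminorm_nonneg[OF seminorm unit_seq_in])
      let ?f = "\<lambda>n. (\<Prod>l=1..m. b l) * (norm (inverse (W 0 (n + m))) * p j (unit_seq (n + m)))"
      have "?f \<longlonglongrightarrow> (\<Prod>l=1..m. b l) * 0"
        using lim LIMSEQ_ignore_initial_segment[of _ 0 m] by (intro tendsto_intros) blast
      then have "?f \<longlonglongrightarrow> 0"
        by simp
      then show ?thesis
      proof (rule tendsto_sandwich[OF _ _ tendsto_const, rotated 2])
        show "\<forall>\<^sub>F n in sequentially. 0 \<le> norm (inverse (W m n)) * p j (unit_seq (n + m))"
          using nonneg by simp
        have "norm (inverse (W m n)) * p j (unit_seq (n + m)) \<le> ?f n" for n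
        proof -
          let ?c = "\<Prod>l=1..m. v (n + m - l) l"
          have "?c \<noteq> 0"
            by (auto simp: nonzero)
          then have "norm (inverse (W m n)) = norm ?c * norm (inverse (W 0 (n + m)))"
            unfolding W_shift by (simp add: norm_mult norm_inverse)
          moreover have "norm ?c \<le> (\<Prod>l=1..m. b l)"
            unfolding prod_norm[symmetric] by (intro prod_mono) (auto simp: b)
          ultimately show ?thesis
            using mult_right_mono[OF _ nonneg] by (simp add: mult.assoc)
        qed
        then show "\<forall>\<^sub>F n in sequentially. norm (inverse (W m n)) * p j (unit_seq (n + m)) \<le> ?f n"
          by simp
      qed
    qed
    show "mixing X S"
      unfolding mixing_def
    proof (intro allI impI)
      fix U V assume UV: "openin X U \<and> U \<noteq> {} \<and> openin X V \<and> V \<noteq> {}"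
      obtain u K where u: "(\<Sum>m<K. seq_scale (u m) (unit_seq m)) \<in> U"
        using open_contains_truncation[of U] UV by blast
      obtain y L where y: "(\<Sum>m<L. seq_scale (y m) (unit_seq m)) \<in> V"
        using open_contains_truncation[of V] UV by blast
      define u' where "u' = (\<Sum>m<K. seq_scale (u m) (unit_seq m))"
      \<comment> \<open>\<open>z n\<close> is the preimage of the finite sequence \<open>y\<close>, shifted forward by \<open>n\<close> places.\<close>
      define z where "z n = (\<Sum>m<L. seq_scale (inverse (W m n) * y m) (unit_seq (m + n)))" for n
      have u'_in: "u' \<in> topspace X" and z_in: "z n \<in> topspace X" for n
        unfolding u'_def z_def by (intro sum_in scale_in unit_seq_in)+
      have "(\<lambda>n. p j (z n)) \<longlonglongrightarrow> 0" for j
      proof (rule tendsto_sandwich[OF _ _ tendsto_const])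
        let ?g = "\<lambda>n. \<Sum>m<L. norm (y m) * (norm (inverse (W m n)) * p j (unit_seq (n + m)))"
        have "?g \<longlonglongrightarrow> (\<Sum>m<L. norm (y m) * 0)"
          by (intro tendsto_intros lim_W)
        then show "?g \<longlonglongrightarrow> 0"
          by simp
        show "\<forall>\<^sub>F n in sequentially. 0 \<le> p j (z n)"
          by (simp add: seminorm_nonneg[OF seminorm] z_in)
        have "p j (z n) \<le> ?g n" for n
        proof -
          have "p j (z n) \<le> (\<Sum>m<L. p j (seq_scale (inverse (W m n) * y m) (unit_seq (m + n))))"
            unfolding z_def by (intro seminorm_sum[OF seminorm] scale_in unit_seq_in)
          also have "\<dots> = ?g n"
            by (intro sum.cong)
              (simp_all add: seminorm_scale[OF seminorm] unit_seq_in norm_mult add.commute)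
          finally show ?thesis .
        qed
        then show "\<forall>\<^sub>F n in sequentially. p j (z n) \<le> ?g n"
          by simp
      qed
      then have "limitin X (\<lambda>n. u' + z n) u' sequentially"
        by (subst limitin_iff_seminorms) (simp_all add: add_in u'_in z_in)
      then have "\<forall>\<^sub>F n in sequentially. u' + z n \<in> U"
        using UV u by (intro limitinD) (auto simp: u'_def)
      then obtain N where N: "\<And>n. n \<ge> N \<Longrightarrow> u' + z n \<in> U"
        by (auto simp: eventually_sequentially)
      have "S n (u' + z n) = (\<Sum>m<L. seq_scale (y m) (unit_seq m))" if "n \<ge> K" for n
      proof
        fix j
        have "u' (j + n) = 0"
          using that by (simp add: u'_def truncation_apply)
        moreover have "z n (j + n) = (if j < L then inverse (W j n) * y j else 0)"
          unfolding z_def finite_expansion_apply by simp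
        ultimately show "S n (u' + z n) j = (\<Sum>m<L. seq_scale (y m) (unit_seq m)) j"
          using W_nonzero[of j n] by (simp add: S_W add_in u'_in z_in truncation_apply)
      qed
      then have "S n (u' + z n) \<in> V" if "n \<ge> max N K" for n
        using that y by simp
      moreover have "S n (u' + z n) \<in> S n ` U" if "n \<ge> max N K" for n
        using that by (intro imageI N) simp
      ultimately have "S n ` U \<inter> V \<noteq> {}" if "n \<ge> max N K" for n
        using that by blast
      then show "\<exists>N\<ge>1. \<forall>n\<ge>N. S n ` U \<inter> V \<noteq> {}"
        by (intro exI[of _ "max 1 (max N K)"]) simp
    qed
  qed
  then show ?thesis
    using limit_iff by (simp add: W_def)
qed

end

section \<open>Random products\<close>

theorem theorem1p2:
  fixes X :: "(nat \<Rightarrow> 'k::{real_normed_field,banach}) topology"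
    and M :: "'w measure" and \<tau> :: "'w \<Rightarrow> 'w"
    and k :: nat and A :: "nat \<Rightarrow> 'w set"
    and w :: "nat \<Rightarrow> nat \<Rightarrow> 'k"
    and B :: "nat \<Rightarrow> (nat \<Rightarrow> 'k) \<Rightarrow> (nat \<Rightarrow> 'k)"
    and T :: "'w \<Rightarrow> (nat \<Rightarrow> 'k) \<Rightarrow> (nat \<Rightarrow> 'k)"
    and \<epsilon> :: "nat \<Rightarrow> 'w \<Rightarrow> 'k"
  assumes "frechet_sequence_space X"
    and "schauder_basis X unit_seq"
    and "measure_preserving_system M \<tau>"
    and "k \<ge> 1"
    and "\<And>l. l \<in> {1..k} \<Longrightarrow> A l \<in> sets M"
    and "disjoint_family_on A {1..k}"
    and "(\<Union>l\<in>{1..k}. A l) = space M"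
    and "\<And>l. l \<in> {1..k} \<Longrightarrow> measure M (A l) > 0"
    and "\<And>l n. l \<in> {1..k} \<Longrightarrow> n \<ge> 1 \<Longrightarrow> w l n \<noteq> 0"
    and "\<And>l. l \<in> {1..k} \<Longrightarrow> continuous_weighted_shift X (w l) (B l)"
    and "\<And>l \<omega>. l \<in> {1..k} \<Longrightarrow> \<omega> \<in> A l \<Longrightarrow> T \<omega> = B l"
    and "\<And>l \<omega> n. l \<in> {1..k} \<Longrightarrow> \<omega> \<in> A l \<Longrightarrow> n \<ge> 1 \<Longrightarrow> \<epsilon> n \<omega> = w l n"
  shows "\<forall>\<omega>\<in>space M.
    mixing X (\<lambda>n. random_product \<tau> T n \<omega>) \<longleftrightarrow>
    limitin X (\<lambda>n. seq_scale (inverse (\<Prod>l=1..n. \<epsilon> l ((\<tau> ^^ (n - l)) \<omega>))) (unit_seq n))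
      0 sequentially"
proof
  fix \<omega> assume \<omega>: "\<omega> \<in> space M"
  obtain p where "frechet_topology_by X p"
    using assms(1) by (auto simp: frechet_sequence_space_def)
  with assms(1,2) interpret frechet_unit_basis X p
    by unfold_locales (auto simp: frechet_sequence_space_def)
  have \<tau>: "\<tau> \<in> measurable M M"
    using assms(3) by (simp add: measure_preserving_system_def)
  have orbit: "(\<tau> ^^ i) \<omega> \<in> space M" for i
    by (induction i) (use \<omega> measurable_space[OF \<tau>] in auto)
  have cell: "\<exists>l\<in>{1..k}. (\<tau> ^^ i) \<omega> \<in> A l" for i
    using orbit[of i] assms(7) by blast
  define v where "v i n = \<epsilon> n ((\<tau> ^^ i) \<omega>)" for i n
  have v_weight: "\<exists>l\<in>{1..k}. \<forall>n\<ge>1. v i n = w l n" for i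
    using cell[of i] assms(12) unfolding v_def by blast
  have v_nonzero: "v i n \<noteq> 0" if "n \<ge> 1" for i n
    using v_weight[of i] assms(9) that by metis
  have v_bounded: "bounded (range (\<lambda>i. v i n))" if "n \<ge> 1" for n
  proof (rule bounded_subset)
    show "bounded ((\<lambda>l. w l n) ` {1..k})"
      by (intro finite_imp_bounded) simp
    show "range (\<lambda>i. v i n) \<subseteq> (\<lambda>l. w l n) ` {1..k}"
      using v_weight that by fastforce
  qed
  have step: "T ((\<tau> ^^ i) \<omega>) x \<in> topspace X \<and> (\<forall>j. T ((\<tau> ^^ i) \<omega>) x j = v i (Suc j) * x (Suc j))"
    if x: "x \<in> topspace X" for i x
  proof -
    obtain l where l: "l \<in> {1..k}" "(\<tau> ^^ i) \<omega> \<in> A l"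
      using cell by blast
    have "T ((\<tau> ^^ i) \<omega>) = B l"
      using assms(11)[OF l] .
    moreover have "continuous_map X X (B l)"
      using assms(10)[OF l(1)] by (simp add: continuous_weighted_shift_def)
    ultimately show ?thesis
      using weighted_shift_apply[OF assms(10)[OF l(1)] x] continuous_map_image_subset_topspace x
        assms(12)[OF l] by (fastforce simp: v_def)
  qed
  have orbit_product: "random_product \<tau> T n \<omega> x \<in> topspace X \<and>
      (\<forall>j. random_product \<tau> T n \<omega> x j = (\<Prod>l=1..n. v (n - l) (j + l)) * x (j + n))"
    if x: "x \<in> topspace X" for n x
  proof (induction n)
    case (Suc n)
    have weights: "(\<Prod>l=1..Suc n. v (Suc n - l) (j + l)) = v n (Suc j) * (\<Prod>l=1..n. v (n - l) (Suc j + l))" for j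
    proof -
      have "(\<Prod>l=1..Suc n. v (Suc n - l) (j + l)) =
          v n (Suc j) * (\<Prod>l=Suc 1..Suc n. v (Suc n - l) (j + l))"
        by (subst prod.atLeast_Suc_atMost) auto
      also have "(\<Prod>l=Suc 1..Suc n. v (Suc n - l) (j + l)) = (\<Prod>l=1..n. v (n - l) (Suc j + l))"
        by (subst prod.shift_bounds_cl_Suc_ivl) simp
      finally show ?thesis .
    qed
    let ?y = "random_product \<tau> T n \<omega> x"
    have y: "?y \<in> topspace X"
      using Suc by blast
    have next_product: "random_product \<tau> T (Suc n) \<omega> x = T ((\<tau> ^^ n) \<omega>) ?y"
      by simp
    show ?case
      unfolding next_product
    proof (intro conjI allI)
      show "T ((\<tau> ^^ n) \<omega>) ?y \<in> topspace X"
        using step[OF y] by blast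
      fix j
      have "T ((\<tau> ^^ n) \<omega>) ?y j = v n (Suc j) * ?y (Suc j)"
        using step[OF y] by blast
      also have "?y (Suc j) = (\<Prod>l=1..n. v (n - l) (Suc j + l)) * x (Suc j + n)"
        using Suc by blast
      finally show "T ((\<tau> ^^ n) \<omega>) ?y j =
          (\<Prod>l=1..Suc n. v (Suc n - l) (j + l)) * x (j + Suc n)"
        unfolding weights by (simp add: mult.assoc)
    qed
  qed (simp add: x)
  have "mixing X (\<lambda>n. random_product \<tau> T n \<omega>) \<longleftrightarrow>
      limitin X (\<lambda>n. seq_scale (inverse (\<Prod>l=1..n. v (n - l) l)) (unit_seq n)) 0 sequentially"
    using v_nonzero v_bounded orbit_product by (intro mixing_weighted_products_iff) simp_all
  then show "mixing X (\<lambda>n. random_product \<tau> T n \<omega>) \<longleftrightarrow>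
      limitin X (\<lambda>n. seq_scale (inverse (\<Prod>l=1..n. \<epsilon> l ((\<tau> ^^ (n - l)) \<omega>))) (unit_seq n))
        0 sequentially"
    by (simp add: v_def)
qed

end
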